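(* Let $\gamma>0$, and let $\theta_*\in\mathcal M$ be a minimizer of $\mathcal G$ over $\mathcal M$. Assume that $$D_\Omega(\theta\|\theta')\le\gamma\,D^\phi(\theta\|\theta')\quad\text{for all }\theta,\theta'\in\mathcal M,$$ and that $D_\Omega(\theta_*\|\theta')\ge 0$ for all $\theta'\in\mathcal M$. Let $\theta^{[1]}\in\mathcal M$ be any initial element and let $\theta^{[t+1]}:=\Gamma^{(e),\phi}_{\mathcal M}(\mathcal F_\gamma(\theta^{[t]}))$ for $t\ge1$. Then for every positive integer $t_0$, $$\mathcal G(\theta^{[t_0+1]})-\mathcal G(\theta_* )\le\frac{\gamma\,D^\phi(\theta_*\|\theta^{[1]})}{t_0}.$$
   Context: Bregman system: $\Theta\subset\mathbb R^d$ is an open convex set and $\phi:\Theta\to\mathbb R$ is a $C^2$ strictly convex function. For $\theta\in\Theta$ put $\eta_j(\theta):=\partial\phi/\partial\theta^j(\theta)$, $\eta(\theta)=(\eta_1(\theta),\dots,\eta_d(\theta))$ (the map $\theta\mapsto\eta(\theta)$ is injective). The Bregman divergence is $$D^\phi(\theta_1\|\theta_2):=\sum_{j=1}^d\eta_j(\theta_1)(\theta_1^j-\theta_2^j)-\phi(\theta_1)+\phi(\theta_2),\qquad \theta_1,\theta_2\in\Theta.$$ Mixture family: given linearly independent vectors $u_1,\dots,u_d\in\mathbb R^d$, $k=d-d_0$, and $c\in\mathbb R^k$, $\mathcal M:=\{\theta\in\Theta:\ \sum_{i=1}^d u^i_{d_0+j}\,\partial_i\phi(\theta)=c_j,\ j=1,\dots,k\}$.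 e-projection: for $\bar\theta\in\Theta$, $\Gamma^{(e),\phi}_{\mathcal M}(\bar\theta):=\operatorname{argmin}_{\theta'\in\mathcal M}D^\phi(\theta'\|\bar\theta)$; it is assumed that this minimizer exists whenever the e-projection is used. Objective function: the set $\mathcal D:=\{\eta(\theta):\theta\in\mathcal M\}\subset\mathbb R^d$ is assumed convex, $\tilde\Omega=(\tilde\Omega^1,\dots,\tilde\Omega^d):\mathcal D\to\mathbb R^d$ is a function, and for $\theta\in\mathcal M$ we set $\Omega(\theta):=\tilde\Omega(\eta(\theta))$ and $\mathcal G(\theta):=\sum_{j=1}^d\eta_j(\theta)\Omega^j(\theta)$. For $\theta,\theta'\in\mathcal M$, $D_\Omega(\theta\|\theta'):=\sum_{j=1}^d\eta_j(\theta)\big(\Omega^j(\theta)-\Omega^j(\theta')\big)$. Conversion function: $\mathcal F_\gamma(\theta):=\theta-\frac1\gamma\Omega(\theta)$, assumed to take values in $\Theta$. *)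

theory Defs
  imports "HOL-Analysis.Analysis"
begin

(* The continuity of f' refers to the operator norm on bounded linear maps; only meant for open S. *)
definition C1_on :: "'a::real_normed_vector set \<Rightarrow> ('a \<Rightarrow> 'b::real_normed_vector) \<Rightarrow> bool" where
  "C1_on S f \<longleftrightarrow>
     (\<exists>f' :: 'a \<Rightarrow> 'a \<Rightarrow>\<^sub>L 'b.
        (\<forall>x\<in>S. (f has_derivative blinfun_apply (f' x)) (at x)) \<and> continuous_on S f')"

definition C2_on :: "'a::real_normed_vector set \<Rightarrow> ('a \<Rightarrow> 'b::real_normed_vector) \<Rightarrow> bool" where
  "C2_on S f \<longleftrightarrow>
     (\<exists>f' :: 'a \<Rightarrow> 'a \<Rightarrow>\<^sub>L 'b.
        (\<forall>x\<in>S. (f has_derivative blinfun_apply (f' x)) (at x)) \<and> C1_on S f')"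

definition strictly_convex_on :: "'a::real_vector set \<Rightarrow> ('a \<Rightarrow> real) \<Rightarrow> bool" where
  "strictly_convex_on S f \<longleftrightarrow>
     convex S \<and>
     (\<forall>x\<in>S. \<forall>y\<in>S. \<forall>s. x \<noteq> y \<and> 0 < s \<and> s < 1 \<longrightarrow>
        f ((1 - s) *\<^sub>R x + s *\<^sub>R y) < (1 - s) * f x + s * f y)"

definition partial_deriv :: "'d::finite \<Rightarrow> (real ^ 'd \<Rightarrow> real) \<Rightarrow> real ^ 'd \<Rightarrow> real" where
  "partial_deriv j f x = deriv (\<lambda>s. f (x + s *\<^sub>R axis j 1)) 0"

definition bregman_system :: "(real ^ 'd::finite) set \<Rightarrow> (real ^ 'd \<Rightarrow> real) \<Rightarrow> bool" where
  "bregman_system \<Theta> \<phi> \<longleftrightarrow> open \<Theta> \<and> convex \<Theta> \<and> C2_on \<Theta> \<phi> \<and> strictly_convex_on \<Theta> \<phi>"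

definition eta :: "(real ^ 'd::finite \<Rightarrow> real) \<Rightarrow> real ^ 'd \<Rightarrow> real ^ 'd" where
  "eta \<phi> \<theta> = (\<chi> j. partial_deriv j \<phi> \<theta>)"

definition bregman_div :: "(real ^ 'd::finite \<Rightarrow> real) \<Rightarrow> real ^ 'd \<Rightarrow> real ^ 'd \<Rightarrow> real" where
  "bregman_div \<phi> \<theta>1 \<theta>2 =
     (\<Sum>j\<in>UNIV. eta \<phi> \<theta>1 $ j * (\<theta>1 $ j - \<theta>2 $ j)) - \<phi> \<theta>1 + \<phi> \<theta>2"

(* With d = CARD('d), the vectors are u 1, ..., u d; the family is linearly independent as an
   indexed family, so repetitions are excluded. *)
definition lin_indep_family :: "(nat \<Rightarrow> real ^ 'd::finite) \<Rightarrow> bool" where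
  "lin_indep_family u \<longleftrightarrow> inj_on u {1..CARD('d)} \<and> independent (u ` {1..CARD('d)})"

(* The point c of R^k, k = CARD('d) - d0, is given by the values c 1, ..., c k. *)
definition mixture_family ::
  "(real ^ 'd::finite) set \<Rightarrow> (real ^ 'd \<Rightarrow> real) \<Rightarrow> (nat \<Rightarrow> real ^ 'd) \<Rightarrow> nat \<Rightarrow> (nat \<Rightarrow> real)
     \<Rightarrow> (real ^ 'd) set" where
  "mixture_family \<Theta> \<phi> u d0 c =
     {\<theta> \<in> \<Theta>. \<forall>j\<in>{1..CARD('d) - d0}. (\<Sum>i\<in>UNIV. u (d0 + j) $ i * partial_deriv i \<phi> \<theta>) = c j}"

(* The value is unspecified if no minimizer exists. *)
definition e_proj ::
  "(real ^ 'd::finite \<Rightarrow> real) \<Rightarrow> (real ^ 'd) set \<Rightarrow> real ^ 'd \<Rightarrow> real ^ 'd" where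
  "e_proj \<phi> M \<theta> = arg_min_on (\<lambda>\<theta>'. bregman_div \<phi> \<theta>' \<theta>) M"

definition e_proj_exists ::
  "(real ^ 'd::finite \<Rightarrow> real) \<Rightarrow> (real ^ 'd) set \<Rightarrow> real ^ 'd \<Rightarrow> bool" where
  "e_proj_exists \<phi> M \<theta> \<longleftrightarrow> (\<exists>\<theta>'. is_arg_min (\<lambda>\<theta>'. bregman_div \<phi> \<theta>' \<theta>) (\<lambda>\<theta>'. \<theta>' \<in> M) \<theta>')"

(* Below, \<Omega>t is a total function of which only the values on eta \<phi> ` M matter. *)
definition Omega ::
  "(real ^ 'd::finite \<Rightarrow> real) \<Rightarrow> (real ^ 'd \<Rightarrow> real ^ 'd) \<Rightarrow> real ^ 'd \<Rightarrow> real ^ 'd" where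
  "Omega \<phi> \<Omega>t \<theta> = \<Omega>t (eta \<phi> \<theta>)"

definition obj_G ::
  "(real ^ 'd::finite \<Rightarrow> real) \<Rightarrow> (real ^ 'd \<Rightarrow> real ^ 'd) \<Rightarrow> real ^ 'd \<Rightarrow> real" where
  "obj_G \<phi> \<Omega>t \<theta> = (\<Sum>j\<in>UNIV. eta \<phi> \<theta> $ j * Omega \<phi> \<Omega>t \<theta> $ j)"

definition D_Omega ::
  "(real ^ 'd::finite \<Rightarrow> real) \<Rightarrow> (real ^ 'd \<Rightarrow> real ^ 'd) \<Rightarrow> real ^ 'd \<Rightarrow> real ^ 'd \<Rightarrow> real" where
  "D_Omega \<phi> \<Omega>t \<theta> \<theta>' =
     (\<Sum>j\<in>UNIV. eta \<phi> \<theta> $ j * (Omega \<phi> \<Omega>t \<theta> $ j - Omega \<phi> \<Omega>t \<theta>' $ j))"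

definition conv_F ::
  "(real ^ 'd::finite \<Rightarrow> real) \<Rightarrow> (real ^ 'd \<Rightarrow> real ^ 'd) \<Rightarrow> real \<Rightarrow> real ^ 'd \<Rightarrow> real ^ 'd" where
  "conv_F \<phi> \<Omega>t \<gamma> \<theta> = \<theta> - (1 / \<gamma>) *\<^sub>R Omega \<phi> \<Omega>t \<theta>"

end

theory Submission
  imports Defs
begin

text \<open>With \<open>\<phi>\<^sup>*\<close> the Legendre transform and \<open>\<eta> = \<eta>(\<theta>)\<close>, the divergence is
  \<open>D(\<theta> \<parallel> \<theta>') = \<phi>\<^sup>*(\<eta>) - \<eta> \<bullet> \<theta>' + \<phi>(\<theta>')\<close>, so up to a constant the e-projection of
  \<open>F(\<theta>\<^sub>t)\<close> minimizes \<open>J(\<theta>) = \<gamma> D(\<theta> \<parallel> \<theta>\<^sub>t) + \<eta> \<bullet> \<Omega>(\<theta>\<^sub>t) = \<G>(\<theta>) + \<gamma> D(\<theta> \<parallel> \<theta>\<^sub>t) - D\<^sub>\<Omega>(\<theta> \<parallel> \<theta>\<^sub>t)\<close>,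
  which majorizes \<open>\<G>\<close> and agrees with it at \<open>\<theta>\<^sub>t\<close>. As \<open>\<eta>(M)\<close> is convex, the minimizer satisfies a
  Pythagorean inequality, which gives \<open>\<G>(\<theta>\<^sub>t\<^sub>+\<^sub>1) - \<G>(\<theta>\<^sub>*) \<le> \<gamma> (D(\<theta>\<^sub>* \<parallel> \<theta>\<^sub>t) - D(\<theta>\<^sub>* \<parallel> \<theta>\<^sub>t\<^sub>+\<^sub>1))\<close>.
  This telescopes, and \<open>\<G>(\<theta>\<^sub>t)\<close> is decreasing.\<close>

section \<open>The gradient of the potential and its continuity\<close>

lemma eta_eq_gradient:
  fixes f' :: "(real ^ 'd::finite) \<Rightarrow>\<^sub>L real"
  assumes "(\<phi> has_derivative blinfun_apply f') (at x)"
  shows "eta \<phi> x = (\<chi> j. f' (axis j 1))"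
proof -
  have "((\<lambda>s. \<phi> (x + s *\<^sub>R axis j 1)) has_field_derivative f' (axis j 1)) (at 0)" for j
  proof -
    have "((\<lambda>s. x + s *\<^sub>R axis j 1) has_derivative (\<lambda>s. s *\<^sub>R axis j 1)) (at (0::real))"
      by (auto intro!: derivative_eq_intros)
    then have "((\<lambda>s. \<phi> (x + s *\<^sub>R axis j 1)) has_derivative (\<lambda>s. f' (s *\<^sub>R axis j 1))) (at 0)"
      using has_derivative_compose[where g = \<phi> and g' = "blinfun_apply f'"] assms by fastforce
    then show ?thesis
      by (rule has_derivative_imp_has_field_derivative) (simp add: blinfun.scaleR_right)
  qed
  then show ?thesis
    unfolding eta_def partial_deriv_def by (auto simp: vec_eq_iff intro!: DERIV_imp_deriv)
qed

lemma has_derivative_inner_eta: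
  fixes f' :: "(real ^ 'd::finite) \<Rightarrow>\<^sub>L real"
  assumes "(\<phi> has_derivative blinfun_apply f') (at x)"
  shows "(\<phi> has_derivative (\<lambda>h. eta \<phi> x \<bullet> h)) (at x)"
proof -
  have "f' h = eta \<phi> x \<bullet> h" for h
  proof -
    have "f' h = f' (\<Sum>j\<in>UNIV. h $ j *\<^sub>R axis j 1)"
      using basis_expansion[of h] by (simp add: scalar_mult_eq_scaleR)
    also have "\<dots> = eta \<phi> x \<bullet> h"
      by (simp add: eta_eq_gradient[OF assms] blinfun.sum_right blinfun.scaleR_right
          inner_vec_def mult.commute)
    finally show ?thesis .
  qed
  then show ?thesis
    using assms by presburger
qed

lemma bregman_system_has_derivative:
  assumes "bregman_system \<Theta> \<phi>" and "x \<in> \<Theta>"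
  shows "(\<phi> has_derivative (\<lambda>h. eta \<phi> x \<bullet> h)) (at x)"
  using assms has_derivative_inner_eta unfolding bregman_system_def C2_on_def by blast

lemma continuous_on_eta:
  assumes "bregman_system \<Theta> \<phi>"
  shows "continuous_on \<Theta> (eta \<phi>)"
proof -
  obtain f' where f': "\<And>x. x \<in> \<Theta> \<Longrightarrow> (\<phi> has_derivative blinfun_apply (f' x)) (at x)"
    and "C1_on \<Theta> f'"
    using assms unfolding bregman_system_def C2_on_def by blast
  then have "continuous_on \<Theta> f'"
    unfolding C1_on_def
    by (meson continuous_at_imp_continuous_on has_derivative_continuous)
  then have "continuous_on \<Theta> (\<lambda>x. \<chi> j. f' x (axis j 1))"
    by (intro continuous_intros)
  then show ?thesis
    by (rule continuous_on_eq) (simp add: eta_eq_gradient[OF f'])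
qed

section \<open>Positivity of the divergence and injectivity of the gradient map\<close>

lemma bregman_div_inner:
  "bregman_div \<phi> x y = eta \<phi> x \<bullet> (x - y) - \<phi> x + \<phi> y"
  by (simp add: bregman_div_def inner_vec_def)

lemma D_Omega_inner:
  "D_Omega \<phi> \<Omega>t x y = eta \<phi> x \<bullet> (Omega \<phi> \<Omega>t x - Omega \<phi> \<Omega>t y)"
  by (simp add: D_Omega_def inner_vec_def)

lemma obj_G_inner: "obj_G \<phi> \<Omega>t x = eta \<phi> x \<bullet> Omega \<phi> \<Omega>t x"
  by (simp add: obj_G_def inner_vec_def)

lemma bregman_div_self [simp]: "bregman_div \<phi> x x = 0"
  by (simp add: bregman_div_inner)

text \<open>This is the gradient inequality: by convexity the difference quotients from
  \<open>x\<close> towards \<open>y\<close> stay below \<open>\<phi> y - \<phi> x\<close>, and they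
  tend to the directional derivative.\<close>

lemma bregman_div_nonneg:
  assumes bs: "bregman_system \<Theta> \<phi>" and x: "x \<in> \<Theta>" and y: "y \<in> \<Theta>"
  shows "bregman_div \<phi> x y \<ge> 0"
proof (cases "x = y")
  case False
  have "((\<lambda>s. x + s *\<^sub>R (y - x)) has_derivative (\<lambda>s. s *\<^sub>R (y - x))) (at (0::real))"
    by (auto intro!: derivative_eq_intros)
  then have "((\<lambda>s. \<phi> (x + s *\<^sub>R (y - x))) has_derivative (\<lambda>s. eta \<phi> x \<bullet> (s *\<^sub>R (y - x)))) (at 0)"
    using has_derivative_compose[where g = \<phi> and g' = "\<lambda>h. eta \<phi> x \<bullet> h"]
      bregman_system_has_derivative[OF bs x] by fastforce
  then have "((\<lambda>s. \<phi> (x + s *\<^sub>R (y - x))) has_field_derivative eta \<phi> x \<bullet> (y - x)) (at 0)"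
    by (rule has_derivative_imp_has_field_derivative) simp
  then have lim: "((\<lambda>s. (\<phi> (x + s *\<^sub>R (y - x)) - \<phi> x) / s) \<longlongrightarrow> eta \<phi> x \<bullet> (y - x)) (at_right 0)"
    by (auto simp: DERIV_def intro: filterlim_mono[OF _ order_refl] at_le)
  have "(\<phi> (x + s *\<^sub>R (y - x)) - \<phi> x) / s \<le> \<phi> y - \<phi> x" if s: "s > 0" "s < 1" for s
  proof -
    have "\<phi> ((1 - s) *\<^sub>R x + s *\<^sub>R y) < (1 - s) * \<phi> x + s * \<phi> y"
      using bs x y False s unfolding bregman_system_def strictly_convex_on_def by blast
    moreover have "(1 - s) *\<^sub>R x + s *\<^sub>R y = x + s *\<^sub>R (y - x)"
      by (simp add: algebra_simps)
    ultimately show ?thesis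
      using s by (simp add: field_simps)
  qed
  then have "\<forall>\<^sub>F s in at_right 0. (\<phi> (x + s *\<^sub>R (y - x)) - \<phi> x) / s \<le> \<phi> y - \<phi> x"
    unfolding eventually_at_right_field by (metis zero_less_one)
  then have "eta \<phi> x \<bullet> (y - x) \<le> \<phi> y - \<phi> x"
    using tendsto_upperbound[OF lim] by simp
  then show ?thesis
    by (simp add: bregman_div_inner inner_diff_right)
qed simp

text \<open>The limit above loses strictness. It is recovered by applying the weak inequality at the
  midpoint \<open>m\<close>, where strict convexity is available.\<close>

lemma bregman_div_pos:
  assumes bs: "bregman_system \<Theta> \<phi>" and x: "x \<in> \<Theta>" and y: "y \<in> \<Theta>" and "x \<noteq> y"
  shows "bregman_div \<phi> x y > 0"
proof -
  define m where "m = (1 - 1/2) *\<^sub>R x + (1/2::real) *\<^sub>R y"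
  have "m \<in> \<Theta>"
    using bs x y unfolding bregman_system_def m_def by (intro convexD) auto
  then have "0 \<le> bregman_div \<phi> x m"
    using bregman_div_nonneg bs x by blast
  moreover have "\<phi> m < (1 - 1/2) * \<phi> x + (1/2) * \<phi> y"
  proof -
    have "\<forall>s. x \<noteq> y \<and> 0 < s \<and> s < 1 \<longrightarrow> \<phi> ((1 - s) *\<^sub>R x + s *\<^sub>R y) < (1 - s) * \<phi> x + s * \<phi> y"
      using bs x y unfolding bregman_system_def strictly_convex_on_def by blast
    from this[rule_format, of "1/2"] show ?thesis
      using \<open>x \<noteq> y\<close> by (simp add: m_def)
  qed
  moreover have "x - m = (1/2) *\<^sub>R (x - y)"
    by (simp add: m_def scaleR_right_diff_distrib flip: scaleR_diff_left)
  ultimately show ?thesis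
    by (simp add: bregman_div_inner)
qed

text \<open>The symmetrized divergence of \<open>x\<close> and \<open>y\<close> is
  \<open>(eta \<phi> x - eta \<phi> y) \<bullet> (x - y)\<close>, which vanishes if the gradients
  agree.\<close>

lemma inj_on_eta:
  assumes "bregman_system \<Theta> \<phi>"
  shows "inj_on (eta \<phi>) \<Theta>"
proof (rule inj_onI, rule ccontr)
  fix x y assume "x \<in> \<Theta>" "y \<in> \<Theta>" "x \<noteq> y" and eq: "eta \<phi> x = eta \<phi> y"
  then have "bregman_div \<phi> x y > 0" "bregman_div \<phi> y x > 0"
    using bregman_div_pos[OF assms] by auto
  then show False
    by (simp add: bregman_div_inner eq inner_diff_right)
qed

text \<open>The Hessian of \<open>\<phi>\<close> may be singular, so continuity of \<open>\<eta>\<^sup>-\<^sup>1\<close> comes from invariance of domain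
  rather than from the inverse function theorem.\<close>

lemma continuous_on_inv_eta:
  assumes "bregman_system \<Theta> \<phi>"
  obtains g where "continuous_on (eta \<phi> ` \<Theta>) g" and "\<And>x. x \<in> \<Theta> \<Longrightarrow> g (eta \<phi> x) = x"
proof -
  have "open \<Theta>"
    using assms by (simp add: bregman_system_def)
  then obtain g where "homeomorphism \<Theta> (eta \<phi> ` \<Theta>) (eta \<phi>) g"
    using invariance_of_domain_homeomorphism[OF _ continuous_on_eta[OF assms] _ inj_on_eta[OF assms]]
    by auto
  then show thesis
    using that by (auto simp: homeomorphism_def)
qed

section \<open>Three-point identity and the e-projection\<close>

lemma bregman_div_three_point:
  "bregman_div \<phi> x z = bregman_div \<phi> x y + bregman_div \<phi> y z + (eta \<phi> x - eta \<phi> y) \<bullet> (y - z)"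
  by (simp add: bregman_div_inner inner_diff_left inner_diff_right)

lemma e_proj_is_arg_min:
  assumes "e_proj_exists \<phi> M z"
  shows "is_arg_min (\<lambda>x. bregman_div \<phi> x z) (\<lambda>x. x \<in> M) (e_proj \<phi> M z)"
  using assms unfolding e_proj_exists_def e_proj_def arg_min_on_def arg_min_def by (rule someI_ex)

lemma bregman_pythagorean:
  assumes bs: "bregman_system \<Theta> \<phi>" and "M \<subseteq> \<Theta>" and conv: "convex (eta \<phi> ` M)"
    and "x \<in> M" and min: "is_arg_min (\<lambda>x. bregman_div \<phi> x z) (\<lambda>x. x \<in> M) y"
  shows "bregman_div \<phi> x y + bregman_div \<phi> y z \<le> bregman_div \<phi> x z"
proof -
  have "y \<in> M" and min: "\<And>v. v \<in> M \<Longrightarrow> bregman_div \<phi> y z \<le> bregman_div \<phi> v z"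
    using min by (auto simp: is_arg_min_linorder)
  obtain g where contg: "continuous_on (eta \<phi> ` \<Theta>) g" and g: "\<And>v. v \<in> \<Theta> \<Longrightarrow> g (eta \<phi> v) = v"
    using continuous_on_inv_eta[OF bs] by blast
  define p where "p s = (1 - s) *\<^sub>R eta \<phi> y + s *\<^sub>R eta \<phi> x" for s :: real
  have p_in: "p s \<in> eta \<phi> ` M" if "s \<in> {0..1}" for s
    unfolding p_def using that \<open>x \<in> M\<close> \<open>y \<in> M\<close> by (intro convexD[OF conv]) auto
  text \<open>Instead of differentiating \<open>\<phi>\<^sup>*\<close> at \<open>\<eta>(y)\<close>, we use its subgradient \<open>v\<close> at nearby points of the
    segment, that is, \<open>D(y \<parallel> v) \<ge> 0\<close>, and pass to the limit.\<close>
  have "(eta \<phi> x - eta \<phi> y) \<bullet> (g (p s) - z) \<ge> 0" if s: "s > 0" "s < 1" for s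
  proof -
    obtain v where v: "v \<in> M" "eta \<phi> v = p s"
      using p_in[of s] s by auto
    have "bregman_div \<phi> y v \<ge> 0"
      using bregman_div_nonneg[OF bs] v \<open>y \<in> M\<close> \<open>M \<subseteq> \<Theta>\<close> by blast
    \<comment> \<open>The inner product equals D(y, v) + (D(v, z) - D(y, z)); the bracket is
      nonnegative by minimality of \<open>y\<close>.\<close>
    then have "0 \<le> (eta \<phi> v - eta \<phi> y) \<bullet> (v - z)"
      using min[OF v(1)] bregman_div_three_point[of \<phi> y z v]
      by (simp add: inner_diff_left)
    also have "eta \<phi> v - eta \<phi> y = s *\<^sub>R (eta \<phi> x - eta \<phi> y)"
      by (simp add: v p_def algebra_simps)
    finally have "0 \<le> (eta \<phi> x - eta \<phi> y) \<bullet> (v - z)"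
      using s by (simp add: zero_le_mult_iff)
    then show ?thesis
      using g v \<open>M \<subseteq> \<Theta>\<close> by (metis subsetD)
  qed
  then have ev: "\<forall>\<^sub>F s in at_right 0. (eta \<phi> x - eta \<phi> y) \<bullet> (g (p s) - z) \<ge> 0"
    unfolding eventually_at_right_field by (metis zero_less_one)
  have "continuous_on {0..1} (\<lambda>s. g (p s))"
  proof (rule continuous_on_compose2[OF contg])
    show "continuous_on {0..1} p"
      unfolding p_def by (intro continuous_intros)
    show "p ` {0..1} \<subseteq> eta \<phi> ` \<Theta>"
      using p_in \<open>M \<subseteq> \<Theta>\<close> by blast
  qed
  then have "((\<lambda>s. g (p s)) \<longlongrightarrow> g (p 0)) (at_right 0)"
    using continuous_on_Icc_at_rightD by fastforce
  moreover have "g (p 0) = y"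
    using g \<open>y \<in> M\<close> \<open>M \<subseteq> \<Theta>\<close> by (auto simp: p_def)
  ultimately have "((\<lambda>s. (eta \<phi> x - eta \<phi> y) \<bullet> (g (p s) - z)) \<longlongrightarrow>
      (eta \<phi> x - eta \<phi> y) \<bullet> (y - z)) (at_right 0)"
    by (intro tendsto_intros) simp
  then have "0 \<le> (eta \<phi> x - eta \<phi> y) \<bullet> (y - z)"
    using ev by (rule tendsto_lowerbound) simp
  then show ?thesis
    using bregman_div_three_point[of \<phi> x z y] by linarith
qed

section \<open>Descent estimate and convergence rate\<close>

text \<open>Shifting the second argument adds the linear term
  \<open>eta \<phi> x \<bullet> Omega \<phi> \<Omega>t y\<close>, which is \<open>obj_G\<close>
  minus \<open>D_Omega\<close>. The last summand is free of \<open>x\<close>, so it cancels when two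
  points are compared.\<close>

lemma bregman_div_conv_F:
  assumes "\<gamma> > 0"
  shows "\<gamma> * bregman_div \<phi> x (conv_F \<phi> \<Omega>t \<gamma> y) =
    obj_G \<phi> \<Omega>t x + \<gamma> * bregman_div \<phi> x y - D_Omega \<phi> \<Omega>t x y
      + \<gamma> * (\<phi> (conv_F \<phi> \<Omega>t \<gamma> y) - \<phi> y)"
  using assms
  by (simp add: bregman_div_inner obj_G_inner D_Omega_inner conv_F_def inner_diff_right
      inner_add_right field_simps)

text \<open>In the induction, \<open>mono\<close> replaces the \<open>n\<close> earlier copies of
  \<open>a (n + 1)\<close> by \<open>a (n + 2)\<close>, and \<open>step\<close> pays for one more
  copy.\<close>

lemma telescoping_average_bound:
  fixes a b :: "nat \<Rightarrow> real"
  assumes step: "\<And>t. t \<ge> 1 \<Longrightarrow> a (t + 1) \<le> b t - b (t + 1)"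
    and mono: "\<And>t. t \<ge> 1 \<Longrightarrow> a (t + 1) \<le> a t"
  shows "real n * a (n + 1) \<le> b 1 - b (n + 1)"
proof (induction n)
  case (Suc n)
  have "real n * a (Suc n + 1) \<le> real n * a (n + 1)"
    using mono[of "n + 1"] by (intro mult_left_mono) auto
  then show ?case
    using Suc step[of "n + 1"] by (simp add: algebra_simps)
qed simp

theorem theorem2:
  fixes \<Theta> M :: "(real ^ 'd::finite) set"
    and \<phi> :: "real ^ 'd \<Rightarrow> real"
    and u :: "nat \<Rightarrow> real ^ 'd" and d0 :: nat and c :: "nat \<Rightarrow> real"
    and \<Omega>t :: "real ^ 'd \<Rightarrow> real ^ 'd"
    and \<gamma> :: real
    and \<theta>s :: "real ^ 'd"
    and \<theta> :: "nat \<Rightarrow> real ^ 'd"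
    and t0 :: nat
  assumes "bregman_system \<Theta> \<phi>"
    and "lin_indep_family u" and "d0 \<le> CARD('d)"
    and "M = mixture_family \<Theta> \<phi> u d0 c"
    and "convex (eta \<phi> ` M)"
    and "\<gamma> > 0"
    and "\<And>\<theta>'. \<theta>' \<in> M \<Longrightarrow> conv_F \<phi> \<Omega>t \<gamma> \<theta>' \<in> \<Theta>"
    and "is_arg_min (obj_G \<phi> \<Omega>t) (\<lambda>\<theta>'. \<theta>' \<in> M) \<theta>s"
    and "\<And>\<theta>1 \<theta>2. \<lbrakk>\<theta>1 \<in> M; \<theta>2 \<in> M\<rbrakk> \<Longrightarrow> D_Omega \<phi> \<Omega>t \<theta>1 \<theta>2 \<le> \<gamma> * bregman_div \<phi> \<theta>1 \<theta>2"
    and "\<And>\<theta>'. \<theta>' \<in> M \<Longrightarrow> D_Omega \<phi> \<Omega>t \<theta>s \<theta>' \<ge> 0"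
    and "\<theta> 1 \<in> M"
    and "\<And>t. t \<ge> 1 \<Longrightarrow> e_proj_exists \<phi> M (conv_F \<phi> \<Omega>t \<gamma> (\<theta> t))"
    and "\<And>t. t \<ge> 1 \<Longrightarrow> \<theta> (t + 1) = e_proj \<phi> M (conv_F \<phi> \<Omega>t \<gamma> (\<theta> t))"
    and "t0 \<ge> 1"
  shows "obj_G \<phi> \<Omega>t (\<theta> (t0 + 1)) - obj_G \<phi> \<Omega>t \<theta>s \<le> \<gamma> * bregman_div \<phi> \<theta>s (\<theta> 1) / real t0"
proof -
  let ?G = "obj_G \<phi> \<Omega>t" and ?D = "bregman_div \<phi>"
  note bs = assms(1) and \<gamma> = assms(6)
  have sub: "M \<subseteq> \<Theta>"
    using assms(4) by (auto simp: mixture_family_def)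
  have s: "\<theta>s \<in> M"
    using assms(8) by (simp add: is_arg_min_def)
  have proj: "is_arg_min (\<lambda>x. ?D x (conv_F \<phi> \<Omega>t \<gamma> (\<theta> t))) (\<lambda>x. x \<in> M) (\<theta> (t + 1))"
    if "t \<ge> 1" for t
    using e_proj_is_arg_min[OF assms(12)[OF that]] assms(13)[OF that] by simp
  have inM: "\<theta> t \<in> M" if "t \<ge> 1" for t
    using that
  proof (induction t rule: dec_induct)
    case (step n)
    then show ?case
      using proj[of n] by (simp add: is_arg_min_def)
  qed (use assms(11) in simp)
  \<comment> \<open>The comparison point \<open>x\<close> stays arbitrary: \<open>\<theta> t\<close>
    yields descent, \<open>\<theta>s\<close> the telescoping bound.\<close>
  have progress: "?G (\<theta> (t + 1)) \<le> ?G x + \<gamma> * ?D x (\<theta> t) - D_Omega \<phi> \<Omega>t x (\<theta> t)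
      - \<gamma> * ?D x (\<theta> (t + 1))" if t: "t \<ge> 1" and x: "x \<in> M" for t x
  proof -
    let ?z = "conv_F \<phi> \<Omega>t \<gamma> (\<theta> t)"
    have "\<gamma> * (?D x (\<theta> (t + 1)) + ?D (\<theta> (t + 1)) ?z) \<le> \<gamma> * ?D x ?z"
      using bregman_pythagorean[OF bs sub assms(5) x proj[OF t]] \<gamma> by simp
    moreover have "D_Omega \<phi> \<Omega>t (\<theta> (t + 1)) (\<theta> t) \<le> \<gamma> * ?D (\<theta> (t + 1)) (\<theta> t)"
      using assms(9) inM t by simp
    ultimately show ?thesis
      by (simp add: distrib_left bregman_div_conv_F[OF \<gamma>])
  qed
  have mono: "?G (\<theta> (t + 1)) \<le> ?G (\<theta> t)" if t: "t \<ge> 1" for t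
  proof -
    have "0 \<le> \<gamma> * ?D (\<theta> t) (\<theta> (t + 1))"
      using bregman_div_nonneg[OF bs] inM t sub \<gamma> by (simp add: subset_eq)
    then show ?thesis
      \<comment> \<open>At \<open>x = \<theta> t\<close> both the divergence to
        \<open>\<theta> t\<close> and the \<open>D_Omega\<close> term vanish.\<close>
      using progress[OF t inM[OF t]] by (simp add: D_Omega_inner)
  qed
  have "?G (\<theta> (t + 1)) - ?G \<theta>s \<le> \<gamma> * ?D \<theta>s (\<theta> t) - \<gamma> * ?D \<theta>s (\<theta> (t + 1))" if t: "t \<ge> 1" for t
    using progress[OF t s] assms(10)[OF inM[OF t]] by linarith
  then have "real t0 * (?G (\<theta> (t0 + 1)) - ?G \<theta>s) \<le> \<gamma> * ?D \<theta>s (\<theta> 1) - \<gamma> * ?D \<theta>s (\<theta> (t0 + 1))"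
    using telescoping_average_bound[where a = "\<lambda>t. ?G (\<theta> t) - ?G \<theta>s"
        and b = "\<lambda>t. \<gamma> * ?D \<theta>s (\<theta> t)"] mono by simp
  also have "\<dots> \<le> \<gamma> * ?D \<theta>s (\<theta> 1)"
    using bregman_div_nonneg[OF bs, of \<theta>s "\<theta> (t0 + 1)"] inM[of "t0 + 1"] s sub \<gamma>
    by (simp add: subset_eq)
  finally show ?thesis
    using assms(14) by (simp add: field_simps)
qed

end
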